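(* Let $X\in L^0_d$. The following are equivalent: (a) For every $w\in C^+\setminus\{0\}$, the cumulative distribution function $F_{w^TX}\colon\mathbb{R}\to[0,1]$ of the real random variable $w^TX$ is strictly increasing. (b) For every $D\in\mathcal{G}(\mathbb{R}^d,C)$, $D=\mathrm{cl}_\Phi(D)$.
   Context: Let $d\ge1$, let $(\Omega,\mathcal{A},\mathbb{P})$ be a probability space and let $L^0_d$ be the space of (equivalence classes of) random variables with values in $\mathbb{R}^d$. Let $C$ be a nonempty closed convex cone with $C\subsetneq\mathbb{R}^d$ (neither nonempty interior nor pointedness is assumed). Its dual cone is $C^+=\{w\in\mathbb{R}^d\mid w^Tz\ge0\text{ for all }z\in C\}$. Let $\mathcal{G}(\mathbb{R}^d,C)=\{D\subseteq\mathbb{R}^d\mid D=\mathrm{cl}\,\mathrm{co}(D+C)\}$ (closed convex hull of the Minkowski sum, with $\emptyset+C=\emptyset$). For $w\in\mathbb{R}^d\setminus\{0\}$ and $z\in\mathbb{R}^d$: $F_{X,w}(z)=\mathbb{P}\{w^TX\le w^Tz\}=F_{w^TX}(w^Tz)$. Its inf-extension to sets is $F^{\vartriangle}_{X,w}(D)=\inf_{z\in D}F_{X,w}(z)$ for $D\subseteq\mathbb{R}^d$, with $F^{\vartriangle}_{X,w}(\emptyset)=+\infty$. With $\Phi=\{F_{X,w}\mid w\in C^+\setminus\{0\}\}$, the $\Phi$-closure of $D\in\mathcal{G}(\mathbb{R}^d,C)$ is $$\mathrm{cl}_\Phi(D)=\bigcap_{w\in C^+\setminus\{0\}}\{z\in\mathbb{R}^d\mid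 F_{X,w}(z)\ge F^{\vartriangle}_{X,w}(D)\}.$$ *)

theory Defs
  imports "HOL-Probability.Probability"
begin

definition dual_cone :: "'a::euclidean_space set \<Rightarrow> 'a set" where
  "dual_cone C = {w. \<forall>z\<in>C. 0 \<le> w \<bullet> z}"

(* "+" is the Minkowski sum (HOL-Library.Set_Algebras); in particular {} + C = {},
   so the empty set belongs to closed_convex_upper_sets C. *)
definition closed_convex_upper_sets :: "'a::euclidean_space set \<Rightarrow> 'a set set" where
  "closed_convex_upper_sets C = {D. D = closure (convex hull (D + C))}"

definition scalar_cdf :: "'o measure \<Rightarrow> ('o \<Rightarrow> 'a::euclidean_space) \<Rightarrow> 'a \<Rightarrow> 'a \<Rightarrow> real" where
  "scalar_cdf M X w z = measure M {\<omega> \<in> space M. w \<bullet> X \<omega> \<le> w \<bullet> z}"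

(* Extended-real valued, so that the infimum over the empty set is +\<infinity>. *)
definition scalar_cdf_inf :: "'o measure \<Rightarrow> ('o \<Rightarrow> 'a::euclidean_space) \<Rightarrow> 'a \<Rightarrow> 'a set \<Rightarrow> ereal" where
  "scalar_cdf_inf M X w D = (INF z\<in>D. ereal (scalar_cdf M X w z))"

definition Phi_closure ::
  "'o measure \<Rightarrow> ('o \<Rightarrow> 'a::euclidean_space) \<Rightarrow> 'a set \<Rightarrow> 'a set \<Rightarrow> 'a set" where
  "Phi_closure M X C D =
     (\<Inter>w \<in> dual_cone C - {0}. {z. ereal (scalar_cdf M X w z) \<ge> scalar_cdf_inf M X w D})"

lemma scalar_cdf_eq_cdf:
  fixes X :: "'o \<Rightarrow> 'a::euclidean_space"
  assumes "X \<in> borel_measurable M"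
  shows "scalar_cdf M X w z = cdf (distr M borel (\<lambda>\<omega>. w \<bullet> X \<omega>)) (w \<bullet> z)"
proof -
  have "(\<lambda>\<omega>. w \<bullet> X \<omega>) \<in> borel_measurable M"
    using assms by measurable
  moreover have "(\<lambda>\<omega>. w \<bullet> X \<omega>) -` {..w \<bullet> z} \<inter> space M = {\<omega> \<in> space M. w \<bullet> X \<omega> \<le> w \<bullet> z}"
    by auto
  ultimately show ?thesis
    by (simp add: scalar_cdf_def cdf_def measure_distr)
qed

lemma scalar_cdf_inf_empty: "scalar_cdf_inf M X w {} = \<infinity>"
  by (simp add: scalar_cdf_inf_def top_ereal_def)

end

theory Submission
  imports Defs
begin

text \<open>
  Both directions come down to half-spaces. The set \<open>cl\<^sub>\<Phi> D\<close> always contains \<open>D\<close>, so only the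
  reverse inclusion is at stake.

  Suppose that all the scalarised distribution functions are strictly increasing, and let
  \<open>z \<notin> D \<noteq> {}\<close>. A hyperplane with normal \<open>w\<close> separates \<open>z\<close> strictly from the closed convex set
  \<open>D\<close>. Since \<open>w\<close> is bounded below on \<open>D\<close>, and \<open>D\<close> is stable under adding elements of the cone
  \<open>C\<close>, the normal must lie in the dual cone (\<open>bounded_below_imp_dual_cone\<close>). Strict monotonicity
  turns the gap between \<open>w \<bullet> z\<close> and \<open>w \<bullet> D\<close> into a gap between the value of the distribution
  function at \<open>z\<close> and its infimum over \<open>D\<close>, which excludes \<open>z\<close> from \<open>cl\<^sub>\<Phi> D\<close>. The empty set is
  closed as soon as one nonzero dual vector exists, and one does because \<open>C\<close> is proper.

  Conversely, suppose that the distribution function of \<open>w\<^sub>0 \<bullet> X\<close> takes the same value at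
  \<open>s < t\<close>, and take \<open>D = {z. t \<le> w\<^sub>0 \<bullet> z}\<close>. A dual vector \<open>w\<close> that is not a positive multiple of
  \<open>w\<^sub>0\<close> is unbounded below on \<open>D\<close> (\<open>halfspace_unbounded_below\<close>); as distribution functions vanish
  at \<open>-\<infinity>\<close>, such a \<open>w\<close> puts no restriction on \<open>cl\<^sub>\<Phi> D\<close>. Positive multiples of \<open>w\<^sub>0\<close> all give the
  restriction that \<open>w\<^sub>0\<close> gives, and this one cannot tell the level \<open>s\<close> from the level \<open>t\<close>.
  Hence \<open>cl\<^sub>\<Phi> D\<close> contains the hyperplane \<open>{z. w\<^sub>0 \<bullet> z = s}\<close>, which misses \<open>D\<close>.
\<close>

section \<open>Upper sets and dual vectors\<close>

lemma closed_convex_upper_sets_iff: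
  assumes "0 \<in> C"
  shows "D \<in> closed_convex_upper_sets C \<longleftrightarrow> closed D \<and> convex D \<and> D + C \<subseteq> D"
proof
  assume "D \<in> closed_convex_upper_sets C"
  then have D: "D = closure (convex hull (D + C))"
    unfolding closed_convex_upper_sets_def by (rule CollectD)
  have "closed D" "convex D"
    by (subst D; simp add: convex_closure)+
  moreover
  have "D + C \<subseteq> closure (convex hull (D + C))"
    using hull_subset[of "D + C" convex] closure_subset by blast
  then have "D + C \<subseteq> D"
    unfolding D[symmetric] .
  ultimately show "closed D \<and> convex D \<and> D + C \<subseteq> D"
    by blast
next
  assume D: "closed D \<and> convex D \<and> D + C \<subseteq> D"
  have "D \<subseteq> D + C"
    using set_zero_plus2[OF assms, of D] by (simp add: add.commute)
  with D have "D + C = D"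
    by blast
  with D show "D \<in> closed_convex_upper_sets C"
    by (simp add: closed_convex_upper_sets_def hull_same)
qed

text \<open>If \<open>w \<bullet> c < 0\<close> for some \<open>c \<in> C\<close>, then \<open>w\<close> tends to \<open>-\<infinity>\<close> along the ray from any point of
  \<open>D\<close> in direction \<open>c\<close>, and this ray stays inside \<open>D\<close>.\<close>

lemma bounded_below_imp_dual_cone:
  assumes "conic C" "D + C \<subseteq> D" "D \<noteq> {}" and bdd: "\<And>x. x \<in> D \<Longrightarrow> b \<le> w \<bullet> x"
  shows "w \<in> dual_cone C"
  unfolding dual_cone_def
proof (intro CollectI ballI, rule ccontr)
  fix c assume c: "c \<in> C" and "\<not> 0 \<le> w \<bullet> c"
  then have neg: "w \<bullet> c < 0"
    by simp
  obtain d where d: "d \<in> D"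
    using \<open>D \<noteq> {}\<close> by blast
  \<comment> \<open>The step length at which \<open>w\<close> falls to \<open>b - 1\<close> along the ray.\<close>
  define r where "r = (w \<bullet> d - b + 1) / - (w \<bullet> c)"
  have "0 \<le> r"
    using bdd[OF d] neg by (simp add: r_def field_simps)
  then have "d + r *\<^sub>R c \<in> D"
    using \<open>D + C \<subseteq> D\<close> d conicD[OF \<open>conic C\<close> c] by blast
  then have "b \<le> w \<bullet> (d + r *\<^sub>R c)"
    by (rule bdd)
  also have "\<dots> = w \<bullet> d + r * (w \<bullet> c)"
    by (simp add: inner_add_right)
  also have "\<dots> = b - 1"
    using neg by (simp add: r_def)
  finally show False
    by simp
qed

lemma ex_nonzero_dual_cone:
  fixes C :: "'a::euclidean_space set"
  assumes "convex_cone C" "closed C" "C \<noteq> UNIV"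
  shows "\<exists>w. w \<in> dual_cone C - {0}"
proof -
  obtain z where "z \<notin> C"
    using \<open>C \<noteq> UNIV\<close> by blast
  then obtain w b where w: "w \<bullet> z < b" "\<And>x. x \<in> C \<Longrightarrow> b < w \<bullet> x"
    using separating_hyperplane_closed_point[of C z] assms
    by (auto simp: convex_cone_def)
  have "C + C \<subseteq> C"
    using convex_cone_add[OF \<open>convex_cone C\<close>] by (auto elim!: set_plus_elim)
  then have "w \<in> dual_cone C"
    using assms w(2)
    by (intro bounded_below_imp_dual_cone[of C C b]) (auto simp: convex_cone_def less_imp_le)
  moreover have "w \<noteq> 0"
    using w(1) w(2)[OF convex_cone_contains_0[OF \<open>convex_cone C\<close>]] by auto
  ultimately show ?thesis
    by blast
qed

lemma halfspace_mem_closed_convex_upper_sets: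
  assumes "0 \<in> C" "w \<in> dual_cone C"
  shows "{z. t \<le> w \<bullet> z} \<in> closed_convex_upper_sets C"
proof -
  have "t \<le> w \<bullet> x + w \<bullet> c" if "t \<le> w \<bullet> x" "c \<in> C" for x c
    using that assms(2) by (auto simp: dual_cone_def intro: add_increasing2)
  then show ?thesis
    unfolding closed_convex_upper_sets_iff[OF assms(1)]
    by (auto elim!: set_plus_elim
        simp: inner_add_right closed_halfspace_ge convex_halfspace_ge)
qed

text \<open>Farkas' lemma for a single inequality: some direction \<open>u\<close> satisfies \<open>w0 \<bullet> u \<ge> 0\<close> and
  \<open>w \<bullet> u < 0\<close>, and \<open>w\<close> falls without bound along it inside the half-space. Such a \<open>u\<close> is the
  component of \<open>-w\<close> orthogonal to \<open>w0\<close> or, when that component vanishes, \<open>w0\<close> itself, because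
  \<open>w\<close> is then a negative multiple of \<open>w0\<close>.\<close>

lemma halfspace_unbounded_below:
  fixes w w0 :: "'a::real_inner"
  assumes "w \<noteq> 0" "w0 \<noteq> 0" and not_mult: "\<And>c. 0 < c \<Longrightarrow> w \<noteq> c *\<^sub>R w0"
  shows "\<exists>z. t \<le> w0 \<bullet> z \<and> w \<bullet> z \<le> b"
proof -
  have pos: "0 < w0 \<bullet> w0"
    using \<open>w0 \<noteq> 0\<close> by simp
  have "\<exists>u. 0 \<le> w0 \<bullet> u \<and> w \<bullet> u < 0"
  proof -
    define c where "c = (w \<bullet> w0) / (w0 \<bullet> w0)"
    define u where "u = c *\<^sub>R w0 - w"
    have orth: "w0 \<bullet> u = 0"
      using pos by (simp add: u_def c_def inner_diff_right inner_commute)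
    have w: "w = c *\<^sub>R w0 - u"
      by (simp add: u_def)
    have wu: "w \<bullet> u = - (u \<bullet> u)"
      by (subst w) (simp add: inner_diff_left orth)
    show ?thesis
    proof (cases "u = 0")
      case False
      then show ?thesis
        using orth wu by (intro exI[of _ u]) simp
    next
      case True
      then have "w = c *\<^sub>R w0"
        by (simp add: u_def)
      then have "c \<noteq> 0" and "\<not> 0 < c"
        using not_mult[of c] \<open>w \<noteq> 0\<close> by auto
      then have "c < 0"
        by simp
      then have "w \<bullet> w0 < 0"
        using pos \<open>w = c *\<^sub>R w0\<close> by (simp add: mult_neg_pos)
      then show ?thesis
        using pos by (intro exI[of _ w0]) simp
    qed
  qed
  then obtain u where u: "0 \<le> w0 \<bullet> u" "w \<bullet> u < 0"
    by blast
  \<comment> \<open>Start on the hyperplane \<open>w0 \<bullet> z = t\<close> and follow \<open>u\<close> just far enough for \<open>w\<close> to fall to \<open>b\<close>.\<close>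
  define z0 where "z0 = (t / (w0 \<bullet> w0)) *\<^sub>R w0"
  define r where "r = max 0 ((w \<bullet> z0 - b) / - (w \<bullet> u))"
  have "t \<le> w0 \<bullet> (z0 + r *\<^sub>R u)"
    using pos u(1) by (simp add: z0_def r_def inner_add_right)
  moreover have "w \<bullet> (z0 + r *\<^sub>R u) \<le> b"
  proof -
    have "(w \<bullet> z0 - b) / - (w \<bullet> u) \<le> r"
      by (simp add: r_def)
    then have "w \<bullet> z0 - b \<le> r * - (w \<bullet> u)"
      using u(2) by (subst (asm) pos_divide_le_eq) auto
    then show ?thesis
      by (simp add: inner_add_right)
  qed
  ultimately show ?thesis
    by blast
qed

section \<open>Scalarised distribution functions\<close>

lemma scalar_cdf_scaleR:
  assumes "0 < c"
  shows "scalar_cdf M X (c *\<^sub>R w) z = scalar_cdf M X w z"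
  using assms by (simp add: scalar_cdf_def)

lemma subset_Phi_closure: "D \<subseteq> Phi_closure M X C D"
  by (auto simp: Phi_closure_def scalar_cdf_inf_def intro: INF_lower)

text \<open>The distribution function of \<open>w \<bullet> X\<close> vanishes at \<open>-\<infinity>\<close>, and \<open>w \<bullet> z\<close> gets arbitrarily far
  down while \<open>z\<close> ranges over \<open>D\<close>.\<close>

lemma scalar_cdf_inf_nonpos:
  fixes X :: "'o \<Rightarrow> 'a::euclidean_space"
  assumes "prob_space M" "X \<in> borel_measurable M"
    and unbdd: "\<And>b. \<exists>z\<in>D. w \<bullet> z \<le> b"
  shows "scalar_cdf_inf M X w D \<le> 0"
proof (rule ereal_le_epsilon2)
  fix e :: real assume "0 < e"
  define N where "N = distr M borel (\<lambda>\<omega>. w \<bullet> X \<omega>)"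
  interpret prob_space M by fact
  have meas: "(\<lambda>\<omega>. w \<bullet> X \<omega>) \<in> borel_measurable M"
    using assms(2) by measurable
  interpret N: real_distribution N
    unfolding N_def using meas by (rule real_distribution_distr)
  have "eventually (\<lambda>x. cdf N x < e) at_bot"
    using N.cdf_lim_at_bot \<open>0 < e\<close> by (rule order_tendstoD)
  then obtain b where b: "cdf N b < e"
    by (auto simp: eventually_at_bot_linorder)
  obtain z where z: "z \<in> D" "w \<bullet> z \<le> b"
    using unbdd by blast
  have "scalar_cdf_inf M X w D \<le> ereal (scalar_cdf M X w z)"
    unfolding scalar_cdf_inf_def using z(1) by (rule INF_lower)
  also have "scalar_cdf M X w z \<le> e"
    using N.cdf_nondecreasing[OF z(2)] b
    by (simp add: scalar_cdf_eq_cdf[OF assms(2)] N_def)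
  finally show "scalar_cdf_inf M X w D \<le> 0 + ereal e"
    by simp
qed

section \<open>Strict monotonicity and closures\<close>

lemma Phi_closure_eq_if_strict_mono:
  fixes X :: "'o \<Rightarrow> 'a::euclidean_space"
  assumes "X \<in> borel_measurable M"
    and C: "convex_cone C" "closed C" "C \<noteq> UNIV"
    and smono: "\<And>w. w \<in> dual_cone C - {0} \<Longrightarrow>
                  strict_mono (cdf (distr M borel (\<lambda>\<omega>. w \<bullet> X \<omega>)))"
    and "D \<in> closed_convex_upper_sets C"
  shows "D = Phi_closure M X C D"
proof (rule antisym[OF subset_Phi_closure], rule subsetI, rule ccontr)
  fix z assume z: "z \<in> Phi_closure M X C D" and "z \<notin> D"
  have D: "closed D" "convex D" "D + C \<subseteq> D"
    using assms(6) closed_convex_upper_sets_iff[OF convex_cone_contains_0[OF C(1)]] by auto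
  show False
  proof (cases "D = {}")
    case True
    obtain w where "w \<in> dual_cone C - {0}"
      using ex_nonzero_dual_cone[OF C] by blast
    then have "scalar_cdf_inf M X w D \<le> ereal (scalar_cdf M X w z)"
      using z unfolding Phi_closure_def by blast
    then show False
      by (simp add: True scalar_cdf_inf_empty)
  next
    case False
    obtain w b where w: "w \<bullet> z < b" "\<And>x. x \<in> D \<Longrightarrow> b < w \<bullet> x"
      using separating_hyperplane_closed_point[OF D(2,1) \<open>z \<notin> D\<close>] by blast
    have "w \<in> dual_cone C"
      using C(1) D(3) False w(2)
      by (intro bounded_below_imp_dual_cone[of C D b]) (auto simp: convex_cone_def less_imp_le)
    moreover have "w \<noteq> 0"
      using w False by fastforce
    ultimately have w': "w \<in> dual_cone C - {0}"
      by blast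
    define F where "F = cdf (distr M borel (\<lambda>\<omega>. w \<bullet> X \<omega>))"
    have F: "scalar_cdf M X w x = F (w \<bullet> x)" for x
      by (simp add: F_def scalar_cdf_eq_cdf[OF assms(1)])
    have "strict_mono F"
      using smono[OF w'] by (simp add: F_def)
    \<comment> \<open>The level \<open>b\<close>, strictly above \<open>w \<bullet> z\<close>, keeps the inequality strict in the infimum,
      which need not be attained.\<close>
    then have "F (w \<bullet> z) < F b" and "\<And>x. x \<in> D \<Longrightarrow> F b \<le> F (w \<bullet> x)"
      using w by (auto simp: strict_mono_def less_imp_le)
    then have "ereal (F (w \<bullet> z)) < ereal (F b)" "ereal (F b) \<le> scalar_cdf_inf M X w D"
      by (auto simp: scalar_cdf_inf_def F intro!: INF_greatest)
    then have "ereal (scalar_cdf M X w z) < scalar_cdf_inf M X w D"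
      unfolding F by (rule less_le_trans)
    moreover have "scalar_cdf_inf M X w D \<le> ereal (scalar_cdf M X w z)"
      using z w' unfolding Phi_closure_def by blast
    ultimately show False
      by simp
  qed
qed

text \<open>Among all dual vectors only the positive multiples of \<open>w0\<close> constrain the closure of a
  half-space with normal \<open>w0\<close>, so a level \<open>s\<close> that the distribution function of \<open>w0 \<bullet> X\<close>
  cannot distinguish from the boundary level \<open>t\<close> is absorbed into the closure.\<close>

lemma level_subset_Phi_closure_halfspace:
  fixes X :: "'o \<Rightarrow> 'a::euclidean_space"
  assumes "prob_space M" "X \<in> borel_measurable M" "w0 \<noteq> 0"
    and le: "cdf (distr M borel (\<lambda>\<omega>. w0 \<bullet> X \<omega>)) t \<le> cdf (distr M borel (\<lambda>\<omega>. w0 \<bullet> X \<omega>)) s"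
  shows "{z. w0 \<bullet> z = s} \<subseteq> Phi_closure M X C {z. t \<le> w0 \<bullet> z}" (is "_ \<subseteq> Phi_closure M X C ?D")
  unfolding Phi_closure_def
proof (intro subsetI INT_I CollectI)
  fix z w assume z: "z \<in> {z. w0 \<bullet> z = s}" and w: "w \<in> dual_cone C - {0}"
  show "scalar_cdf_inf M X w ?D \<le> ereal (scalar_cdf M X w z)"
  proof (cases "\<exists>c>0. w = c *\<^sub>R w0")
    case True
    then have "scalar_cdf M X w x = scalar_cdf M X w0 x" for x
      by (auto simp: scalar_cdf_scaleR)
    then have F: "scalar_cdf M X w x = cdf (distr M borel (\<lambda>\<omega>. w0 \<bullet> X \<omega>)) (w0 \<bullet> x)" for x
      by (simp add: scalar_cdf_eq_cdf[OF assms(2)])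
    define d where "d = (t / (w0 \<bullet> w0)) *\<^sub>R w0"
    have d: "w0 \<bullet> d = t"
      using \<open>w0 \<noteq> 0\<close> by (simp add: d_def)
    then have "scalar_cdf_inf M X w ?D \<le> ereal (scalar_cdf M X w d)"
      unfolding scalar_cdf_inf_def by (intro INF_lower) simp
    also have "\<dots> \<le> ereal (scalar_cdf M X w z)"
      using le z d by (simp add: F)
    finally show ?thesis .
  next
    case False
    have "\<exists>x\<in>?D. w \<bullet> x \<le> b" for b
      using halfspace_unbounded_below[of w w0 t b] w \<open>w0 \<noteq> 0\<close> False by blast
    then have "scalar_cdf_inf M X w ?D \<le> 0"
      by (rule scalar_cdf_inf_nonpos[OF assms(1,2)])
    also have "0 \<le> ereal (scalar_cdf M X w z)"
      by (simp add: scalar_cdf_def)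
    finally show ?thesis .
  qed
qed

theorem theorem2:
  fixes M :: "'o measure" and X :: "'o \<Rightarrow> real ^ 'n" and C :: "(real ^ 'n) set"
  assumes "prob_space M"
    and "X \<in> borel_measurable M"
    and "convex_cone C" and "closed C" and "C \<noteq> UNIV"
  shows "(\<forall>w \<in> dual_cone C - {0}. strict_mono (cdf (distr M borel (\<lambda>\<omega>. w \<bullet> X \<omega>))))
     \<longleftrightarrow> (\<forall>D \<in> closed_convex_upper_sets C. D = Phi_closure M X C D)"
proof
  assume "\<forall>w \<in> dual_cone C - {0}. strict_mono (cdf (distr M borel (\<lambda>\<omega>. w \<bullet> X \<omega>)))"
  then show "\<forall>D \<in> closed_convex_upper_sets C. D = Phi_closure M X C D"
    using Phi_closure_eq_if_strict_mono[OF assms(2-5)] by blast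
next
  assume closed: "\<forall>D \<in> closed_convex_upper_sets C. D = Phi_closure M X C D"
  show "\<forall>w \<in> dual_cone C - {0}. strict_mono (cdf (distr M borel (\<lambda>\<omega>. w \<bullet> X \<omega>)))"
  proof (intro ballI strict_monoI, rule ccontr)
    fix w and s t :: real
    assume w: "w \<in> dual_cone C - {0}" and "s < t"
      and "\<not> cdf (distr M borel (\<lambda>\<omega>. w \<bullet> X \<omega>)) s < cdf (distr M borel (\<lambda>\<omega>. w \<bullet> X \<omega>)) t"
    then have "{z. w \<bullet> z = s} \<subseteq> Phi_closure M X C {z. t \<le> w \<bullet> z}"
      using assms(1,2) by (intro level_subset_Phi_closure_halfspace) auto
    also have "\<dots> = {z. t \<le> w \<bullet> z}"
    proof (rule sym, rule bspec[OF closed])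
      show "{z. t \<le> w \<bullet> z} \<in> closed_convex_upper_sets C"
        using w convex_cone_contains_0[OF assms(3)]
        by (intro halfspace_mem_closed_convex_upper_sets) auto
    qed
    finally have sub: "{z. w \<bullet> z = s} \<subseteq> {z. t \<le> w \<bullet> z}" .
    have "w \<bullet> ((s / (w \<bullet> w)) *\<^sub>R w) = s"
      using w by simp
    with subsetD[OF sub, of "(s / (w \<bullet> w)) *\<^sub>R w"] have "t \<le> s"
      by (simp only: mem_Collect_eq)
    then show False
      using \<open>s < t\<close> by simp
  qed
qed

end
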